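(* Let $A\subseteq\mathbb{R}$ be an open invex subset with respect to $\eta:A\times A\to\mathbb{R}$. Let $q>1$ and let $p$ satisfy $p^{-1}+q^{-1}=1$. Suppose that $f:A\to\mathbb{R}$ is a three times differentiable function and that $|f'''|^{q}$ is prequasiinvex on $A$ with respect to $\eta$. Then for every $a,b\in A$ with $\eta(b,a)\neq 0$, $$\left|\int_{b}^{b+\eta(a,b)}f(x)\,dx-\eta(a,b)\,\frac{f(b)+f(b+\eta(a,b))}{2}-\frac{(\eta(a,b))^{2}}{12}\left[f'(b)-f'(b+\eta(a,b))\right]\right|\le\frac{(\eta(a,b))^{4}}{24\cdot 3^{\frac1q}}\left(\frac{1}{(p+1)(p+3)}\right)^{\frac1p}\left[\max\left\{|f'''(a)|^{q},|f'''(b)|^{q}\right\}\right]^{\frac1q}.$$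
   Context: A set $A\subseteq\mathbb{R}$ is invex with respect to $\eta:A\times A\to\mathbb{R}$ if $u+t\,\eta(v,u)\in A$ for all $u,v\in A$ and all $t\in[0,1]$. A function $g:A\to\mathbb{R}$ on an invex set $A$ is prequasiinvex with respect to $\eta$ if $g(u+t\,\eta(v,u))\le\max\{g(u),g(v)\}$ for all $u,v\in A$ and all $t\in[0,1]$. Integrals $\int_c^d$ are oriented (the upper limit may be less than the lower limit). *)

theory Defs
  imports "HOL-Analysis.Analysis"
begin

(* Functions on A (one- or two-argument) are rendered as total functions on the reals;
   only their values at points of A matter. *)

definition invex :: "real set \<Rightarrow> (real \<Rightarrow> real \<Rightarrow> real) \<Rightarrow> bool" where
  "invex A \<eta> \<longleftrightarrow> (\<forall>u\<in>A. \<forall>v\<in>A. \<forall>t\<in>{0..1}. u + t * \<eta> v u \<in> A)"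

definition prequasiinvex_on ::
  "real set \<Rightarrow> (real \<Rightarrow> real \<Rightarrow> real) \<Rightarrow> (real \<Rightarrow> real) \<Rightarrow> bool" where
  "prequasiinvex_on A \<eta> g \<longleftrightarrow>
     invex A \<eta> \<and> (\<forall>u\<in>A. \<forall>v\<in>A. \<forall>t\<in>{0..1}. g (u + t * \<eta> v u) \<le> max (g u) (g v))"

(* Meant for open A: there the derivatives at points of A, given by deriv,
   depend only on the values of f on A. *)
definition times_differentiable_on :: "nat \<Rightarrow> (real \<Rightarrow> real) \<Rightarrow> real set \<Rightarrow> bool" where
  "times_differentiable_on n f A \<longleftrightarrow> (\<forall>k<n. (deriv ^^ k) f differentiable_on A)"

end

theory Submission imports Defs begin

text \<open>
  Put \<open>h = \<eta> a b\<close> and \<open>g t = f (b + t * h)\<close> for \<open>t\<close> in \<open>{0..1}\<close>.  The quantity to be estimated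
  is \<open>h\<close> times the error of the corrected trapezoidal rule for \<open>g\<close>.  Integrating by parts three
  times against the kernel \<open>k t = t * (2 * t - 1) * (t - 1) / 12\<close>, which vanishes at both
  endpoints and has third derivative \<open>1\<close>, shows that this error is, up to sign, the integral of
  \<open>k\<close> times the third derivative of \<open>g\<close>.

  Prequasiinvexity bounds \<open>\<bar>f'''\<bar>\<close> by a single constant \<open>M\<close>, the last factor of the claim, along
  the whole segment from \<open>b\<close> to \<open>b + h\<close>.  Hence the error of \<open>g\<close> is at most
  \<open>\<bar>h\<bar> ^ 3 * M\<close> times the \<open>L\<^sup>1\<close> norm of \<open>k\<close>, which is \<open>1 / 192\<close>
  (lemma \<open>corrected_trapezoidal_error\<close>).  The constant in \<open>p\<close> and \<open>q\<close> of the claim is what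
  Hoelder's inequality gives instead of this norm, with weight \<open>t * (1 - t)\<close> and
  \<open>\<bar>2 * t - 1\<bar>\<close> in \<open>L\<^sup>p\<close>; that it is at least as large is an elementary inequality in \<open>p\<close>
  (lemma \<open>hoelder_constant_ge\<close>).

  The third derivative may fail to be continuous.  In the gauge integral this is harmless: the
  fundamental theorem of calculus makes the product of \<open>k\<close> and the third derivative of \<open>g\<close>
  integrable, because this product plus \<open>g\<close> is a derivative at every point.
\<close>

section \<open>The corrected trapezoidal rule\<close>

text \<open>
  The kernel is odd about \<open>1 / 2\<close> and positive to the left of it, so both halves contribute
  the same amount to its \<open>L\<^sup>1\<close> norm.  An antiderivative is \<open>t ^ 2 * (1 - t) ^ 2 / 24\<close>, with value
  \<open>1 / 384\<close> at \<open>1 / 2\<close> and \<open>0\<close> at the endpoints.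
\<close>

lemma has_integral_abs_kernel:
  "((\<lambda>t::real. \<bar>t * (2 * t - 1) * (t - 1) / 12\<bar>) has_integral 1 / 192) {0..1}"
proof -
  define K where "K t = t ^ 2 * (1 - t) ^ 2 / 24" for t :: real
  have deriv_K: "(K has_vector_derivative t * (2 * t - 1) * (t - 1) / 12) (at t within S)" for t S
    unfolding K_def has_real_derivative_iff_has_vector_derivative[symmetric]
    by (auto intro!: derivative_eq_intros simp: field_simps power2_eq_square)
  have left: "((\<lambda>t::real. t * (2 * t - 1) * (t - 1) / 12) has_integral 1 / 384) {0..1/2}"
    using fundamental_theorem_of_calculus[of 0 "1/2" K, OF _ deriv_K]
    by (simp add: K_def power2_eq_square)
  have right: "((\<lambda>t::real. - (t * (2 * t - 1) * (t - 1) / 12)) has_integral 1 / 384) {1/2..1}"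
    using has_integral_neg[OF fundamental_theorem_of_calculus[of "1/2" 1 K, OF _ deriv_K]]
    by (simp add: K_def power2_eq_square)
  have "((\<lambda>t::real. \<bar>t * (2 * t - 1) * (t - 1) / 12\<bar>) has_integral 1 / 384) {0..1/2}"
  proof (rule has_integral_eq[OF _ left])
    fix t :: real assume "t \<in> {0..1/2}"
    then have "0 \<le> t * ((1 - 2 * t) * (1 - t))" by (intro mult_nonneg_nonneg) auto
    then show "t * (2 * t - 1) * (t - 1) / 12 = \<bar>t * (2 * t - 1) * (t - 1) / 12\<bar>"
      by (simp add: algebra_simps)
  qed
  moreover
  have "((\<lambda>t::real. \<bar>t * (2 * t - 1) * (t - 1) / 12\<bar>) has_integral 1 / 384) {1/2..1}"
  proof (rule has_integral_eq[OF _ right])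
    fix t :: real assume "t \<in> {1/2..1}"
    then have "0 \<le> t * ((2 * t - 1) * (1 - t))" by (intro mult_nonneg_nonneg) auto
    then have "t * (2 * t - 1) * (t - 1) / 12 \<le> 0"
      by (simp add: algebra_simps)
    then show "- (t * (2 * t - 1) * (t - 1) / 12) = \<bar>t * (2 * t - 1) * (t - 1) / 12\<bar>"
      by simp
  qed
  ultimately have "((\<lambda>t::real. \<bar>t * (2 * t - 1) * (t - 1) / 12\<bar>)
      has_integral 1 / 384 + 1 / 384) {0..1}"
    by (intro has_integral_combine[of 0 "1/2" 1]) simp_all
  then show ?thesis
    by simp
qed

text \<open>
  Three integrations by parts are carried out at once: with
  \<open>k t = t * (2 * t - 1) * (t - 1) / 12\<close>, the function \<open>P = k * g2 - k' * g1 + k'' * g\<close> has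
  derivative \<open>k * g3 + k''' * g = k * g3 + g\<close>, and \<open>P 1 - P 0\<close> is the value of the corrected
  trapezoidal rule.
\<close>

lemma corrected_trapezoidal_error:
  fixes g g1 g2 g3 :: "real \<Rightarrow> real"
  assumes g: "\<And>t. t \<in> {0..1} \<Longrightarrow> (g has_real_derivative g1 t) (at t within {0..1})"
    and g1: "\<And>t. t \<in> {0..1} \<Longrightarrow> (g1 has_real_derivative g2 t) (at t within {0..1})"
    and g2: "\<And>t. t \<in> {0..1} \<Longrightarrow> (g2 has_real_derivative g3 t) (at t within {0..1})"
    and bound: "\<And>t. t \<in> {0..1} \<Longrightarrow> \<bar>g3 t\<bar> \<le> B"
  shows "\<bar>integral {0..1} g - (g 0 + g 1) / 2 - (g1 0 - g1 1) / 12\<bar> \<le> B / 192"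
proof -
  define k where "k t = t * (2 * t - 1) * (t - 1) / 12" for t :: real
  define P where "P t = k t * g2 t - (6 * t ^ 2 - 6 * t + 1) / 12 * g1 t + (t - 1/2) * g t" for t
  have "(P has_vector_derivative k t * g3 t + g t) (at t within {0..1})" if "t \<in> {0..1}" for t
    unfolding P_def k_def has_real_derivative_iff_has_vector_derivative[symmetric]
    using that
    by (auto intro!: derivative_eq_intros g g1 g2 simp: field_simps power2_eq_square)
  then have sum: "((\<lambda>t. k t * g3 t + g t) has_integral P 1 - P 0) {0..1}"
    by (intro fundamental_theorem_of_calculus) auto
  have "continuous_on {0..1} g"
    using g by (blast intro: DERIV_continuous_on)
  then have "(g has_integral integral {0..1} g) {0..1}"
    by (intro integrable_integral integrable_continuous_real)
  from has_integral_diff[OF sum this]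
  have kg3: "((\<lambda>t. k t * g3 t) has_integral P 1 - P 0 - integral {0..1} g) {0..1}"
    by simp
  have kB: "((\<lambda>t. \<bar>k t\<bar> * B) has_integral 1 / 192 * B) {0..1}"
    unfolding k_def by (intro has_integral_mult_left has_integral_abs_kernel)
  have "norm (k t * g3 t) \<le> \<bar>k t\<bar> * B" if "t \<in> {0..1}" for t
    using bound[OF that] by (simp add: abs_mult mult_left_mono)
  then have "norm (integral {0..1} (\<lambda>t. k t * g3 t)) \<le> integral {0..1} (\<lambda>t. \<bar>k t\<bar> * B)"
    using kg3 kB by (intro integral_norm_bound_integral) auto
  then have "\<bar>P 1 - P 0 - integral {0..1} g\<bar> \<le> 1 / 192 * B"
    unfolding integral_unique[OF kg3] integral_unique[OF kB] by simp
  moreover have "P 1 - P 0 = (g 0 + g 1) / 2 + (g1 0 - g1 1) / 12"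
    by (simp add: P_def k_def field_simps)
  ultimately show ?thesis
    by linarith
qed

text \<open>
  The affine substitution \<open>x = b + t * h\<close>; since the integral is oriented, the sign of \<open>h\<close> does
  not matter.
\<close>

lemma interval_integral_affine:
  fixes f :: "real \<Rightarrow> real" and b h :: real
  assumes "continuous_on ((\<lambda>t. b + t * h) ` {0..1}) f"
  shows "(LBINT x=b..b + h. f x) = h * integral {0..1} (\<lambda>t. f (b + t * h))"
proof -
  have cont: "continuous_on {0..1} (\<lambda>t. h * f (b + t * h))"
    by (intro continuous_intros continuous_on_compose2[OF assms]) auto
  have "((\<lambda>t. b + t * h) has_real_derivative h) (at t within {0..1})" for t
    by (auto intro!: derivative_eq_intros)
  then have "(LBINT x=b..b + h. f x) = (LBINT t=0..1. h * f (b + t * h))"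
    using interval_integral_substitution_finite[of 0 1 "\<lambda>t. b + t * h" "\<lambda>_. h" f] assms
    by (simp add: zero_ereal_def one_ereal_def)
  also have "\<dots> = integral {0..1} (\<lambda>t. h * f (b + t * h))"
    using interval_integral_eq_integral[of 0 1 "\<lambda>t. h * f (b + t * h)"]
      borel_integrable_atLeastAtMost'[OF cont]
    by (simp add: zero_ereal_def one_ereal_def)
  finally show ?thesis
    by simp
qed

section \<open>Comparison with the constant from Hoelder's inequality\<close>

text \<open>
  For the probability density \<open>6 * t * (1 - t)\<close> on \<open>{0..1}\<close>, the function \<open>\<bar>2 * t - 1\<bar>\<close> has mean
  \<open>3 / 8\<close> and \<open>p\<close>-th moment \<open>3 / ((p + 1) * (p + 3))\<close>, so this is Jensen's inequality, with
  equality for \<open>p = 1\<close>.  Writing \<open>p = 1 + x\<close>, it amounts to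
  \<open>(1 + x / 2) * (1 + x / 4) \<le> (8 / 3) powr x\<close>.  The left-hand side is at most \<open>exp (3 / 4 * x)\<close>
  since \<open>1 + y \<le> exp y\<close>, and \<open>exp (3 / 4) \<le> 8 / 3\<close>.
\<close>

lemma jensen_kernel_moment:
  fixes p :: real
  assumes "p \<ge> 1"
  shows "(3 / 8) powr p \<le> 3 / ((p + 1) * (p + 3))"
proof -
  define x where "x = p - 1"
  have x: "x \<ge> 0" "p = 1 + x" using assms by (auto simp: x_def)
  have "(3 / 4 :: real) \<le> exp (- (1 / 4))"
    using exp_ge_add_one_self[of "- (1 / 4) :: real"] by simp
  then have "(3 / 4 :: real) ^ 3 \<le> exp (- (1 / 4)) ^ 3"
    by (rule power_mono) simp
  also have "\<dots> = exp (- (3 / 4))"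
    by (simp flip: exp_of_nat_mult)
  finally have "(3 / 8 :: real) powr x \<le> exp (- (3 / 4)) powr x"
    using x by (intro powr_mono2) (auto simp: power3_eq_cube)
  also have "\<dots> = exp (- (3 / 4 * x))"
    by (simp add: powr_def mult.commute)
  finally have pow: "(3 / 8) powr x \<le> exp (- (3 / 4 * x))" .
  have "(1 + x / 2) * (1 + x / 4) \<le> exp (x / 2) * exp (x / 4)"
    using x by (intro mult_mono exp_ge_add_one_self) auto
  also have "\<dots> = exp (3 / 4 * x)"
    by (simp flip: exp_add)
  finally have "(3 / 8) powr x * ((1 + x / 2) * (1 + x / 4))
      \<le> exp (- (3 / 4 * x)) * exp (3 / 4 * x)"
    using x pow by (intro mult_mono) auto
  also have "\<dots> = 1"
    by (simp flip: exp_add)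
  finally have "(3 / 8) powr x * ((1 + x / 2) * (1 + x / 4)) \<le> 1" .
  moreover have "(3 / 8) powr p * ((p + 1) * (p + 3))
      = 3 * ((3 / 8) powr x * ((1 + x / 2) * (1 + x / 4)))"
    unfolding x by (simp add: powr_add field_simps)
  ultimately have "(3 / 8) powr p * ((p + 1) * (p + 3)) \<le> 3"
    by linarith
  moreover have "(p + 1) * (p + 3) > 0"
    using assms by simp
  ultimately show ?thesis
    by (simp add: pos_le_divide_eq)
qed

text \<open>
  After multiplication by \<open>3 = 3 powr (1 / p) * 3 powr (1 / q)\<close> this is the \<open>p\<close>-th root of the
  moment inequality.
\<close>

lemma hoelder_constant_ge:
  fixes p q :: real
  assumes "p \<ge> 1" and conj: "1 / p + 1 / q = 1"
  shows "1 / 8 \<le> (1 / ((p + 1) * (p + 3))) powr (1 / p) / 3 powr (1 / q)"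
proof -
  have "3 / 8 = ((3 / 8) powr p) powr (1 / p)"
    using assms by (simp add: powr_powr)
  also have "\<dots> \<le> (3 / ((p + 1) * (p + 3))) powr (1 / p)"
    using assms by (intro powr_mono2 jensen_kernel_moment) auto
  also have "\<dots> = 3 powr (1 / p) * (1 / ((p + 1) * (p + 3))) powr (1 / p)"
    using assms by (simp flip: powr_mult)
  finally have "3 / 8 \<le> 3 powr (1 / p) * (1 / ((p + 1) * (p + 3))) powr (1 / p)" .
  moreover have "3 powr (1 / p) * 3 powr (1 / q) = (3 :: real)"
    using conj by (simp flip: powr_add)
  then have "3 powr (1 / p) = 3 / (3 powr (1 / q) :: real)"
    by (simp add: field_simps)
  ultimately show ?thesis
    by (simp add: divide_simps mult.commute)
qed

section \<open>The estimate along an invex segment\<close>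

lemma times_differentiable_on_DERIV:
  assumes "open A" "times_differentiable_on n f A" "k < n" "x \<in> A"
  shows "((deriv ^^ k) f has_real_derivative (deriv ^^ Suc k) f x) (at x)"
proof -
  have "(deriv ^^ k) f differentiable (at x)"
    using assms unfolding times_differentiable_on_def differentiable_on_def
    by (metis at_within_open)
  then show ?thesis
    by (simp add: DERIV_deriv_iff_real_differentiable)
qed

theorem theorem5:
  fixes A :: "real set" and \<eta> :: "real \<Rightarrow> real \<Rightarrow> real" and f :: "real \<Rightarrow> real"
    and p q a b :: real
  assumes "open A" and "invex A \<eta>"
    and "q > 1" and "inverse p + inverse q = 1"
    and "times_differentiable_on 3 f A"
    and "prequasiinvex_on A \<eta> (\<lambda>x. \<bar>(deriv ^^ 3) f x\<bar> powr q)"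
    and "a \<in> A" and "b \<in> A" and "\<eta> b a \<noteq> 0"
  shows "\<bar>(LBINT x=b..b + \<eta> a b. f x) - \<eta> a b * ((f b + f (b + \<eta> a b)) / 2)
            - (\<eta> a b)^2 / 12 * (deriv f b - deriv f (b + \<eta> a b))\<bar>
         \<le> (\<eta> a b)^4 / (24 * 3 powr (1 / q)) * (1 / ((p + 1) * (p + 3))) powr (1 / p)
            * (max (\<bar>(deriv ^^ 3) f a\<bar> powr q) (\<bar>(deriv ^^ 3) f b\<bar> powr q)) powr (1 / q)"
proof -
  define h where "h = \<eta> a b"
  define M where
    "M = (max (\<bar>(deriv ^^ 3) f a\<bar> powr q) (\<bar>(deriv ^^ 3) f b\<bar> powr q)) powr (1 / q)"
  define C where "C = (1 / ((p + 1) * (p + 3))) powr (1 / p) / 3 powr (1 / q)"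
  define g where "g k t = h ^ k * (deriv ^^ k) f (b + t * h)" for k t

  have "inverse q < 1" "inverse q > 0"
    using \<open>q > 1\<close> by (auto simp: inverse_less_1_iff)
  then have "inverse p > 0" "inverse p < 1"
    using assms(4) by linarith+
  then have "p > 1"
    by (auto simp: inverse_less_1_iff)
  then have C: "1 / 8 \<le> C"
    unfolding C_def using assms(4) by (intro hoelder_constant_ge) (auto simp: inverse_eq_divide)

  have in_A: "b + t * h \<in> A" if "t \<in> {0..1}" for t
    using assms(2,7,8) that unfolding invex_def h_def by blast
  have deriv_f: "((deriv ^^ k) f has_real_derivative (deriv ^^ Suc k) f x) (at x)"
    if "k < 3" "x \<in> A" for k x
    using times_differentiable_on_DERIV assms(1,5) that by blast
  have deriv_g: "(g k has_real_derivative g (Suc k) t) (at t within {0..1})"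
    if "k < 3" "t \<in> {0..1}" for k t
  proof -
    have "((\<lambda>t. b + t * h) has_real_derivative h) (at t within {0..1})"
      by (auto intro!: derivative_eq_intros)
    from DERIV_cmult[OF DERIV_chain2[OF deriv_f[OF that(1) in_A[OF that(2)]] this], of "h ^ k"]
    show ?thesis
      by (simp add: g_def[abs_def] mult_ac)
  qed
  have "\<bar>(deriv ^^ 3) f (b + t * h)\<bar> \<le> M" if "t \<in> {0..1}" for t
  proof -
    have "\<bar>(deriv ^^ 3) f (b + t * h)\<bar> powr q
        \<le> max (\<bar>(deriv ^^ 3) f a\<bar> powr q) (\<bar>(deriv ^^ 3) f b\<bar> powr q)"
      using assms(6,7,8) that unfolding prequasiinvex_on_def h_def by (metis max.commute)
    then have "(\<bar>(deriv ^^ 3) f (b + t * h)\<bar> powr q) powr (1 / q) \<le> M"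
      unfolding M_def using \<open>q > 1\<close> by (intro powr_mono2) auto
    then show ?thesis
      using \<open>q > 1\<close> by (simp add: powr_powr)
  qed
  then have bound: "\<bar>g 3 t\<bar> \<le> \<bar>h\<bar> ^ 3 * M" if "t \<in> {0..1}" for t
    using that by (auto simp: g_def abs_mult power_abs intro!: mult_left_mono)

  have "\<bar>integral {0..1} (g 0) - (g 0 0 + g 0 1) / 2 - (g 1 0 - g 1 1) / 12\<bar>
      \<le> \<bar>h\<bar> ^ 3 * M / 192"
    using corrected_trapezoidal_error[of "g 0" "g 1" "g 2" "g 3" "\<bar>h\<bar> ^ 3 * M"]
      deriv_g[of 0] deriv_g[of 1] deriv_g[of 2] bound
    by (simp add: numeral_2_eq_2 numeral_3_eq_3)
  then have "\<bar>h\<bar> * \<bar>integral {0..1} (g 0) - (g 0 0 + g 0 1) / 2 - (g 1 0 - g 1 1) / 12\<bar>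
      \<le> \<bar>h\<bar> * (\<bar>h\<bar> ^ 3 * M / 192)"
    by (rule mult_left_mono) simp
  also have "\<dots> = h ^ 4 / 24 * (1 / 8) * M"
    by (simp add: power_abs[symmetric] abs_mult[symmetric] flip: power_Suc)
  also have "\<dots> \<le> h ^ 4 / 24 * C * M"
    using C by (intro mult_right_mono mult_left_mono) (auto simp: M_def)
  finally have main:
    "\<bar>h * (integral {0..1} (g 0) - (g 0 0 + g 0 1) / 2 - (g 1 0 - g 1 1) / 12)\<bar>
      \<le> h ^ 4 / 24 * C * M"
    by (simp add: abs_mult)

  have "continuous_on A ((deriv ^^ 0) f)"
    by (rule DERIV_continuous_on, rule has_field_derivative_at_within, rule deriv_f) auto
  then have "continuous_on ((\<lambda>t. b + t * h) ` {0..1}) f"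
    using in_A by (auto elim!: continuous_on_subset)
  then have "(LBINT x=b..b + h. f x) = h * integral {0..1} (g 0)"
    by (simp add: interval_integral_affine g_def[abs_def])
  then have "(LBINT x=b..b + h. f x) - h * ((f b + f (b + h)) / 2)
        - h ^ 2 / 12 * (deriv f b - deriv f (b + h))
      = h * (integral {0..1} (g 0) - (g 0 0 + g 0 1) / 2 - (g 1 0 - g 1 1) / 12)"
    by (simp add: g_def algebra_simps power2_eq_square)
  with main show ?thesis
    by (simp add: C_def M_def h_def)
qed

end
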